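(* Let $(X,d,\ll,\leq,\tau)$ be an intrinsic, quasi-strongly causal, locally causally closed Lorentzian pre-length space and let $\Omega\colon X\to(0,+\infty)$ be continuous. Let $\alpha,\beta\colon[0,b)\to X$ be two timelike curves of the same time orientation (both future directed or both past directed) with $\alpha(0)=\beta(0)=:p$, and assume that $\tau$ is finite between $p$ and the points of the curves, i.e. $\max(\tau(p,\alpha(s)),\tau(\alpha(s),p))<\infty$ and $\max(\tau(p,\beta(s)),\tau(\beta(s),p))<\infty$ for all $s\in(0,b)$. If the angle between $\alpha$ and $\beta$ at $p$ exists in $[0,\infty]$ both with respect to $\tau$ and with respect to $\tau_\Omega$, then the two angles agree: $$\measuredangle_p^\Omega(\alpha,\beta)=\measuredangle_p(\alpha,\beta).$$
   Context: A Lorentzian pre-length space $(X,d,\ll,\leq,\tau)$ consists of a set $X$, a metric $d$ on $X$, two transitive relations $\ll,\leq$ on $X$ with $\leq$ reflexive and $\ll$ contained in $\leq$, and a map $\tau\colon X\times X\to[0,+\infty]$ which is lower semicontinuous with respect to the topology of $d$, satisfies $\tau(x,z)\geq\tau(x,y)+\tau(y,z)$ whenever $x\leq y\leq z$, satisfies $\tau(x,y)=0$ if $x\not\leq y$, and satisfies $\tau(x,y)>0$ if and only if $x\ll y$. A curve is a continuous map from an interval into $X$. A non-constant curve $\gamma\colon I\to X$ is (future directed) causal if $\gamma(t)\leq\gamma(s)$ for all $t<s$ in $I$; it is future directed (past directed) timelike if $\gamma(t)\ll\gamma(s)$ (respectively $\gamma(s)\ll\gamma(t)$) for all $t<s$ in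 $I$. A causal curve from $x$ to $y$ is a future directed causal curve on a compact interval, starting at $x$ and ending at $y$. For a causal curve $\gamma\colon[a,b]\to X$ put $$L_\Omega^\tau(\gamma):=\inf\Big\{\sum_{i=0}^{m-1}\max_{t\in[t_i,t_{i+1}]}\Omega(\gamma(t))\,\tau(\gamma(t_i),\gamma(t_{i+1}))\ :\ a=t_0<\dots<t_m=b\Big\},$$ let $L^\tau(\gamma)$ be the same quantity with $\Omega\equiv1$, and $$\tau_\Omega(x,y):=\sup\big(\{0\}\cup\{L_\Omega^\tau(\gamma):\gamma\text{ a causal curve from }x\text{ to }y\}\big).$$ The space is intrinsic if $\tau(x,y)=\sup(\{0\}\cup\{L^\tau(\gamma):\gamma\text{ a causal curve from }x\text{ to }y\})$ for all $x,y$. It is quasi-strongly causal if for every $x\in X$ and every neighbourhood $U$ of $x$ there is a neighbourhood $V\subseteq U$ of $x$ such that every causal curve with endpoints in $V$ is contained in $U$. It is locally causally closed if every $x\in X$ has a neighbourhood $U$ such that for all sequences $(p_n),(q_n)$ in $U$ converging to $p,q\in\overline U$ with $p_n\leq q_n$ for all $n$, one has $p\leq q$. Angles. Let $\theta\in\{\tau,\tau_\Omega\}$ and $\bar\theta(x,y):=\max(\theta(x,y),\theta(y,x))$. Let $A_0:=\{(s,t)\in(0,b)^2:\alpha(s)\leq\beta(t)\text{ or }\beta(t)\leq\alpha(s)\}$. For $(s,t)\in A_0$ put $A=\bar\theta(p,\alpha(s))$, $B=\bar\theta(p,\beta(t))$, $C=\bar\theta(\alpha(s),\beta(t))$ (for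 $s,t$ small these are finite and $A,B>0$). The comparison angle $\tilde\measuredangle_p^\theta(\alpha(s),\beta(t))\in[0,\infty)$ is the hyperbolic angle at the vertex corresponding to $p$ of a triangle in two-dimensional Minkowski space with side lengths $A,B,C$, i.e. $\cosh\tilde\measuredangle_p^\theta(\alpha(s),\beta(t))=\frac{A^2+B^2-C^2}{2AB}$. The angle between $\alpha$ and $\beta$ with respect to $\theta$ is $$\lim_{(s,t)\in A_0,\ s,t\searrow0}\tilde\measuredangle_p^\theta(\alpha(s),\beta(t)),$$ if this limit exists in $[0,\infty]$; it is denoted $\measuredangle_p(\alpha,\beta)$ for $\theta=\tau$ and $\measuredangle_p^\Omega(\alpha,\beta)$ for $\theta=\tau_\Omega$. *)

theory Defs
  imports "HOL-Analysis.Analysis"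
begin

text \<open>The underlying set is the carrier of a type of class \<open>metric_space\<close>; products carry the
  product topology. Time separation functions take values in \<open>ennreal\<close>.\<close>

locale lorentzian_pre_length_space =
  fixes chron :: "'a::metric_space \<Rightarrow> 'a \<Rightarrow> bool"  (infix "\<lless>" 50)
    and caus :: "'a \<Rightarrow> 'a \<Rightarrow> bool"  (infix "\<preceq>" 50)
    and \<tau> :: "'a \<Rightarrow> 'a \<Rightarrow> ennreal"
  assumes chron_trans: "x \<lless> y \<Longrightarrow> y \<lless> z \<Longrightarrow> x \<lless> z"
    and caus_trans: "x \<preceq> y \<Longrightarrow> y \<preceq> z \<Longrightarrow> x \<preceq> z"
    and caus_refl: "x \<preceq> x"
    and chron_imp_caus: "x \<lless> y \<Longrightarrow> x \<preceq> y"
    and tau_lower_semicontinuous: "open {(x, y). c < \<tau> x y}"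
    and reverse_triangle: "x \<preceq> y \<Longrightarrow> y \<preceq> z \<Longrightarrow> \<tau> x y + \<tau> y z \<le> \<tau> x z"
    and tau_eq_0: "\<not> x \<preceq> y \<Longrightarrow> \<tau> x y = 0"
    and tau_pos_iff: "0 < \<tau> x y \<longleftrightarrow> x \<lless> y"

definition causal_curve ::
    "('a::metric_space \<Rightarrow> 'a \<Rightarrow> bool) \<Rightarrow> real set \<Rightarrow> (real \<Rightarrow> 'a) \<Rightarrow> bool" where
  "causal_curve caus I \<gamma> \<longleftrightarrow>
     is_interval I \<and> continuous_on I \<gamma> \<and> \<not> \<gamma> constant_on I \<and>
     (\<forall>t\<in>I. \<forall>s\<in>I. t < s \<longrightarrow> caus (\<gamma> t) (\<gamma> s))"

definition future_timelike_curve ::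
    "('a::metric_space \<Rightarrow> 'a \<Rightarrow> bool) \<Rightarrow> real set \<Rightarrow> (real \<Rightarrow> 'a) \<Rightarrow> bool" where
  "future_timelike_curve chron I \<gamma> \<longleftrightarrow>
     is_interval I \<and> continuous_on I \<gamma> \<and> \<not> \<gamma> constant_on I \<and>
     (\<forall>t\<in>I. \<forall>s\<in>I. t < s \<longrightarrow> chron (\<gamma> t) (\<gamma> s))"

definition past_timelike_curve ::
    "('a::metric_space \<Rightarrow> 'a \<Rightarrow> bool) \<Rightarrow> real set \<Rightarrow> (real \<Rightarrow> 'a) \<Rightarrow> bool" where
  "past_timelike_curve chron I \<gamma> \<longleftrightarrow>
     is_interval I \<and> continuous_on I \<gamma> \<and> \<not> \<gamma> constant_on I \<and>
     (\<forall>t\<in>I. \<forall>s\<in>I. t < s \<longrightarrow> chron (\<gamma> s) (\<gamma> t))"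

definition causal_curve_from_to ::
    "('a::metric_space \<Rightarrow> 'a \<Rightarrow> bool) \<Rightarrow> 'a \<Rightarrow> 'a \<Rightarrow> real \<Rightarrow> real \<Rightarrow> (real \<Rightarrow> 'a) \<Rightarrow> bool" where
  "causal_curve_from_to caus x y a b \<gamma> \<longleftrightarrow>
     a \<le> b \<and> causal_curve caus {a..b} \<gamma> \<and> \<gamma> a = x \<and> \<gamma> b = y"

text \<open>For continuous \<open>\<Omega>\<close> and \<open>\<gamma>\<close> the supremum over each compact subinterval is a maximum
  and finite.\<close>

definition weighted_length ::
    "('a \<Rightarrow> 'a \<Rightarrow> ennreal) \<Rightarrow> ('a \<Rightarrow> real) \<Rightarrow> real \<Rightarrow> real \<Rightarrow> (real \<Rightarrow> 'a) \<Rightarrow> ennreal" where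
  "weighted_length \<tau> \<Omega> a b \<gamma> =
     Inf {(\<Sum>i<m. (SUP r\<in>{t i..t (Suc i)}. ennreal (\<Omega> (\<gamma> r))) * \<tau> (\<gamma> (t i)) (\<gamma> (t (Suc i)))) | m t.
            t 0 = a \<and> t m = b \<and> (\<forall>i<m. t i < t (Suc i))}"

definition weighted_time_separation ::
    "('a::metric_space \<Rightarrow> 'a \<Rightarrow> bool) \<Rightarrow> ('a \<Rightarrow> 'a \<Rightarrow> ennreal) \<Rightarrow> ('a \<Rightarrow> real) \<Rightarrow> 'a \<Rightarrow> 'a \<Rightarrow> ennreal" where
  "weighted_time_separation caus \<tau> \<Omega> x y =
     Sup ({0} \<union> {weighted_length \<tau> \<Omega> a b \<gamma> | a b \<gamma>. causal_curve_from_to caus x y a b \<gamma>})"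

definition intrinsic ::
    "('a::metric_space \<Rightarrow> 'a \<Rightarrow> bool) \<Rightarrow> ('a \<Rightarrow> 'a \<Rightarrow> ennreal) \<Rightarrow> bool" where
  "intrinsic caus \<tau> \<longleftrightarrow> (\<forall>x y. \<tau> x y = weighted_time_separation caus \<tau> (\<lambda>_. 1) x y)"

text \<open>Neighbourhoods are not required to be open.\<close>

definition quasi_strongly_causal :: "('a::metric_space \<Rightarrow> 'a \<Rightarrow> bool) \<Rightarrow> bool" where
  "quasi_strongly_causal caus \<longleftrightarrow>
     (\<forall>x U. x \<in> interior U \<longrightarrow>
        (\<exists>V. x \<in> interior V \<and> V \<subseteq> U \<and>
           (\<forall>y z a b \<gamma>. y \<in> V \<and> z \<in> V \<and> causal_curve_from_to caus y z a b \<gamma> \<longrightarrow> \<gamma> ` {a..b} \<subseteq> U)))"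

definition locally_causally_closed :: "('a::metric_space \<Rightarrow> 'a \<Rightarrow> bool) \<Rightarrow> bool" where
  "locally_causally_closed caus \<longleftrightarrow>
     (\<forall>x. \<exists>U. x \<in> interior U \<and>
        (\<forall>p q p' q'. (\<forall>n::nat. p n \<in> U \<and> q n \<in> U \<and> caus (p n) (q n)) \<and>
           p' \<in> closure U \<and> q' \<in> closure U \<and> p \<longlonglongrightarrow> p' \<and> q \<longlonglongrightarrow> q' \<longrightarrow> caus p' q'))"

definition sym_separation :: "('a \<Rightarrow> 'a \<Rightarrow> ennreal) \<Rightarrow> 'a \<Rightarrow> 'a \<Rightarrow> ennreal" where
  "sym_separation \<theta> x y = max (\<theta> x y) (\<theta> y x)"

text \<open>The hyperbolic law of cosines, solved for the angle at the vertex corresponding to \<open>p\<close>.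
  The value is only meaningful if all three side lengths are finite and those adjacent to \<open>p\<close> are
  positive (note that \<open>enn2real\<close> sends \<open>\<infinity>\<close> to \<open>0\<close>).\<close>

definition comparison_angle :: "('a \<Rightarrow> 'a \<Rightarrow> ennreal) \<Rightarrow> 'a \<Rightarrow> 'a \<Rightarrow> 'a \<Rightarrow> real" where
  "comparison_angle \<theta> p x y =
     (let A = enn2real (sym_separation \<theta> p x);
          B = enn2real (sym_separation \<theta> p y);
          C = enn2real (sym_separation \<theta> x y)
      in arcosh ((A\<^sup>2 + B\<^sup>2 - C\<^sup>2) / (2 * A * B)))"

definition causally_related_params ::
    "('a \<Rightarrow> 'a \<Rightarrow> bool) \<Rightarrow> real \<Rightarrow> (real \<Rightarrow> 'a) \<Rightarrow> (real \<Rightarrow> 'a) \<Rightarrow> (real \<times> real) set" where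
  "causally_related_params caus b \<alpha> \<beta> =
     {(s, t). s \<in> {0<..<b} \<and> t \<in> {0<..<b} \<and> (caus (\<alpha> s) (\<beta> t) \<or> caus (\<beta> t) (\<alpha> s))}"

text \<open>The causal relation determining the admissible parameters is always that of the space, also
  for \<open>\<theta> = \<tau>\<^sub>\<Omega>\<close>. Limits are taken in \<open>ereal\<close>, so that the value \<open>\<infinity>\<close> is allowed. The filter is
  non-trivial for timelike curves of the same time orientation starting at \<open>p\<close>, since \<open>\<lless>\<close> is
  open; so the limit is unique.\<close>

definition angle_exists ::
    "('a \<Rightarrow> 'a \<Rightarrow> bool) \<Rightarrow> ('a \<Rightarrow> 'a \<Rightarrow> ennreal) \<Rightarrow> real \<Rightarrow> 'a \<Rightarrow> (real \<Rightarrow> 'a) \<Rightarrow> (real \<Rightarrow> 'a) \<Rightarrow> bool" where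
  "angle_exists caus \<theta> b p \<alpha> \<beta> \<longleftrightarrow>
     (\<exists>L::ereal. 0 \<le> L \<and>
        ((\<lambda>(s, t). ereal (comparison_angle \<theta> p (\<alpha> s) (\<beta> t))) \<longlongrightarrow> L)
          (at (0, 0) within causally_related_params caus b \<alpha> \<beta>))"

definition angle ::
    "('a \<Rightarrow> 'a \<Rightarrow> bool) \<Rightarrow> ('a \<Rightarrow> 'a \<Rightarrow> ennreal) \<Rightarrow> real \<Rightarrow> 'a \<Rightarrow> (real \<Rightarrow> 'a) \<Rightarrow> (real \<Rightarrow> 'a) \<Rightarrow> ereal" where
  "angle caus \<theta> b p \<alpha> \<beta> =
     Lim (at (0, 0) within causally_related_params caus b \<alpha> \<beta>)
       (\<lambda>(s, t). ereal (comparison_angle \<theta> p (\<alpha> s) (\<beta> t)))"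

end

theory Submission
  imports Defs
begin

text \<open>
  The idea is to test both limits on pairs of points of \<open>\<alpha>\<close> and \<open>\<beta>\<close> that are causally but not
  chronologically related, where the third side of the comparison triangle vanishes for both time
  separations.

  Quasi-strong causality confines causal curves between points near \<open>p\<close> to a region where \<open>\<Omega>\<close>
  differs from \<open>\<Omega> p\<close> by a factor of at most \<open>exp \<epsilon>\<close>. Together with intrinsicness, this shows that
  \<open>\<tau>\<^sub>\<Omega>\<close> and \<open>\<Omega> p * \<tau>\<close> differ there by at most the same factor
  (\<open>weighted_time_separation_comparable\<close>). For an arbitrary pair \<open>(s, t)\<close> this says little about
  the angles: the quotient \<open>(A\<^sup>2 + B\<^sup>2 - C\<^sup>2) / (2 A B)\<close> is not stable under relative errors when the
  numerator involves cancellation. If \<open>C = 0\<close> there is no cancellation, and the law of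
  cosines reads \<open>cosh \<theta> = (A/B + B/A) / 2\<close>, that is, \<open>\<theta> = \<bar>ln (A/B)\<bar>\<close>
  (\<open>comparison_angle_null\<close>). A common factor of \<open>A\<close> and \<open>B\<close> drops out, and relative errors
  \<open>exp \<epsilon>\<close> in \<open>A\<close> and \<open>B\<close> change \<open>\<theta>\<close> by at most \<open>2 \<epsilon>\<close>, whether or not \<open>\<theta>\<close> stays bounded.

  Such pairs exist arbitrarily close to \<open>p\<close> (\<open>null_related_pair_future\<close>). In the future directed
  case fix a small \<open>s\<close> and follow \<open>\<beta>\<close> to the last parameter \<open>t\<close> with \<open>\<beta> t \<preceq> \<alpha> s\<close>. Local causal
  closedness guarantees that the last parameter is attained, and that it is small together with
  \<open>s\<close>; at it, \<open>\<beta> t \<lless> \<alpha> s\<close> fails because \<open>\<lless>\<close> is open. Since both angles are assumed to exist, it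
  is enough to compare them along a sequence of these pairs.
\<close>

section \<open>Causal relations\<close>

lemma caus_chron_trans:
  fixes chron :: "'a::metric_space \<Rightarrow> 'a \<Rightarrow> bool"  (infix "\<lless>" 50)
    and caus :: "'a \<Rightarrow> 'a \<Rightarrow> bool"  (infix "\<preceq>" 50)
  assumes lpls: "lorentzian_pre_length_space chron caus \<tau>"
    and "x \<preceq> y" "y \<lless> z"
  shows "x \<lless> z"
proof -
  note pos_iff = lorentzian_pre_length_space.tau_pos_iff[OF lpls]
  have "\<tau> x y + \<tau> y z \<le> \<tau> x z"
    using lorentzian_pre_length_space.reverse_triangle[OF lpls \<open>x \<preceq> y\<close>]
      lorentzian_pre_length_space.chron_imp_caus[OF lpls \<open>y \<lless> z\<close>] by blast
  moreover have "0 < \<tau> y z" using \<open>y \<lless> z\<close> by (simp add: pos_iff)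
  ultimately have "0 < \<tau> x z" by (metis add_nonneg_eq_0_iff less_le_trans not_gr_zero zero_le)
  then show ?thesis by (simp add: pos_iff)
qed

text \<open>By the reverse triangle inequality, appending such a loop would increase the finite value \<open>\<tau> p x\<close>.\<close>

lemma no_chron_loop:
  fixes chron :: "'a::metric_space \<Rightarrow> 'a \<Rightarrow> bool"  (infix "\<lless>" 50)
    and caus :: "'a \<Rightarrow> 'a \<Rightarrow> bool"  (infix "\<preceq>" 50)
  assumes lpls: "lorentzian_pre_length_space chron caus \<tau>"
    and "p \<preceq> x" "\<tau> p x < \<infinity>"
  shows "\<not> x \<lless> x"
proof
  assume "x \<lless> x"
  then have "0 < \<tau> x x" by (simp add: lorentzian_pre_length_space.tau_pos_iff[OF lpls])
  moreover have "\<tau> p x + \<tau> x x \<le> \<tau> p x + 0"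
    using lorentzian_pre_length_space.reverse_triangle[OF lpls \<open>p \<preceq> x\<close>
        lorentzian_pre_length_space.caus_refl[OF lpls]] by simp
  ultimately show False
    using assms(3) by (metis ennreal_add_left_cancel_le infinity_ennreal_def leD less_irrefl)
qed

lemma open_chron:
  fixes chron :: "'a::metric_space \<Rightarrow> 'a \<Rightarrow> bool"  (infix "\<lless>" 50)
    and caus :: "'a \<Rightarrow> 'a \<Rightarrow> bool"  (infix "\<preceq>" 50)
  assumes lpls: "lorentzian_pre_length_space chron caus \<tau>"
  shows "open {(x, y). x \<lless> y}"
  using lorentzian_pre_length_space.tau_lower_semicontinuous[OF lpls, of 0]
  by (simp add: lorentzian_pre_length_space.tau_pos_iff[OF lpls])

lemma lorentzian_pre_length_space_dual:
  fixes chron :: "'a::metric_space \<Rightarrow> 'a \<Rightarrow> bool"  (infix "\<lless>" 50)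
    and caus :: "'a \<Rightarrow> 'a \<Rightarrow> bool"  (infix "\<preceq>" 50)
  assumes lpls: "lorentzian_pre_length_space chron caus \<tau>"
  shows "lorentzian_pre_length_space (\<lambda>x y. y \<lless> x) (\<lambda>x y. y \<preceq> x) (\<lambda>x y. \<tau> y x)"
proof
  show "open {(x, y). c < \<tau> y x}" for c
  proof -
    have "{(x, y). c < \<tau> y x} = prod.swap -` {(x, y). c < \<tau> x y}" by auto
    then show ?thesis
      using open_vimage[OF lorentzian_pre_length_space.tau_lower_semicontinuous[OF lpls, of c]
          continuous_on_swap] by simp
  qed
  show "\<tau> y x + \<tau> z y \<le> \<tau> z x" if "y \<preceq> x" "z \<preceq> y" for x y z
    using lorentzian_pre_length_space.reverse_triangle[OF lpls that(2,1)] by (simp add: add.commute)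
qed (blast intro: lorentzian_pre_length_space.chron_trans[OF lpls]
      lorentzian_pre_length_space.caus_trans[OF lpls] lorentzian_pre_length_space.caus_refl[OF lpls]
      lorentzian_pre_length_space.chron_imp_caus[OF lpls] lorentzian_pre_length_space.tau_eq_0[OF lpls]
    | simp add: lorentzian_pre_length_space.tau_pos_iff[OF lpls])+

lemma locally_causally_closed_dual:
  assumes "locally_causally_closed caus"
  shows "locally_causally_closed (\<lambda>x y. caus y x)"
  unfolding locally_causally_closed_def
proof
  fix x
  obtain U where "x \<in> interior U" and
    "\<forall>p q p' q'. (\<forall>n::nat. p n \<in> U \<and> q n \<in> U \<and> caus (p n) (q n)) \<and>
       p' \<in> closure U \<and> q' \<in> closure U \<and> p \<longlonglongrightarrow> p' \<and> q \<longlonglongrightarrow> q' \<longrightarrow> caus p' q'"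
    using assms unfolding locally_causally_closed_def by blast
  then show "\<exists>U. x \<in> interior U \<and>
      (\<forall>p q p' q'. (\<forall>n::nat. p n \<in> U \<and> q n \<in> U \<and> caus (q n) (p n)) \<and>
         p' \<in> closure U \<and> q' \<in> closure U \<and> p \<longlonglongrightarrow> p' \<and> q \<longlonglongrightarrow> q' \<longrightarrow> caus q' p')"
    by blast
qed

section \<open>Causally but not chronologically related points\<close>

lemma future_timelike_curve_start:
  assumes "future_timelike_curve chron {0..<b} \<gamma>" "s \<in> {0<..<b}"
  shows "chron (\<gamma> 0) (\<gamma> s)"
proof -
  have "0 \<in> {0..<b}" "s \<in> {0..<b}" "0 < s" using assms(2) by simp_all
  then show ?thesis using assms(1) unfolding future_timelike_curve_def by blast
qed

lemma past_timelike_curve_start: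
  assumes "past_timelike_curve chron {0..<b} \<gamma>" "s \<in> {0<..<b}"
  shows "chron (\<gamma> s) (\<gamma> 0)"
proof -
  have "0 \<in> {0..<b}" "s \<in> {0..<b}" "0 < s" using assms(2) by simp_all
  then show ?thesis using assms(1) unfolding past_timelike_curve_def by blast
qed

lemma curve_near_start:
  fixes \<gamma> :: "real \<Rightarrow> 'a::metric_space"
  assumes "continuous_on {0..<b} \<gamma>" "0 < b" "\<gamma> 0 \<in> interior U"
  obtains r where "0 < r" "r < b" "\<And>t. 0 \<le> t \<Longrightarrow> t \<le> r \<Longrightarrow> \<gamma> t \<in> U"
proof -
  obtain e where e: "0 < e" "ball (\<gamma> 0) e \<subseteq> U"
    using assms(3) mem_interior by blast
  have "0 \<in> {0..<b}" using assms(2) by simp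
  then obtain d where d: "0 < d" "\<And>t. t \<in> {0..<b} \<Longrightarrow> dist t 0 < d \<Longrightarrow> dist (\<gamma> t) (\<gamma> 0) < e"
    using assms(1)[unfolded continuous_on_iff, rule_format, OF _ e(1)] by blast
  show thesis
  proof (rule that[of "min d b / 2"])
    fix t :: real assume "0 \<le> t" "t \<le> min d b / 2"
    then have "dist (\<gamma> t) (\<gamma> 0) < e"
      using d assms(2) by (intro d(2)) (auto simp: dist_real_def)
    then show "\<gamma> t \<in> U" using e(2) by (auto simp: dist_commute)
  qed (use d assms in auto)
qed

text \<open>
  The pair consists of a point \<open>\<alpha> s\<close> and the last point of \<open>\<beta>\<close> in its causal past. Local causal
  closedness enters twice. If \<open>\<beta>\<close> stayed below \<open>\<alpha> s\<close> up to a fixed parameter \<open>t0\<close> for all small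
  \<open>s\<close>, then \<open>\<beta> t0 \<preceq> p\<close> would close a chronological loop; and the last parameter is attained
  because the causal past of \<open>\<alpha> s\<close> is closed near \<open>p\<close>.
\<close>

lemma null_related_pair_future:
  fixes chron :: "'a::metric_space \<Rightarrow> 'a \<Rightarrow> bool"  (infix "\<lless>" 50)
    and caus :: "'a \<Rightarrow> 'a \<Rightarrow> bool"  (infix "\<preceq>" 50)
  assumes lpls: "lorentzian_pre_length_space chron caus \<tau>"
    and lcc: "locally_causally_closed caus"
    and "0 < b" "0 < \<delta>"
    and \<alpha>: "future_timelike_curve chron {0..<b} \<alpha>" "\<alpha> 0 = p"
    and \<beta>: "future_timelike_curve chron {0..<b} \<beta>" "\<beta> 0 = p"
    and fin: "\<And>t. t \<in> {0<..<b} \<Longrightarrow> \<tau> p (\<beta> t) < \<infinity>"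
  obtains s t where "0 < s" "s < b" "s < \<delta>" "0 < t" "t < b" "t < \<delta>"
    "\<beta> t \<preceq> \<alpha> s" "\<not> \<beta> t \<lless> \<alpha> s" "\<not> \<alpha> s \<lless> \<beta> t"
proof -
  note chron_imp_caus = lorentzian_pre_length_space.chron_imp_caus[OF lpls]
  have \<alpha>c: "continuous_on {0..<b} \<alpha>" and \<beta>c: "continuous_on {0..<b} \<beta>"
    using \<alpha> \<beta> unfolding future_timelike_curve_def by auto
  have p\<alpha>: "p \<lless> \<alpha> s" and p\<beta>: "p \<lless> \<beta> s" if "s \<in> {0<..<b}" for s
    using future_timelike_curve_start[OF \<alpha>(1) that] future_timelike_curve_start[OF \<beta>(1) that] \<alpha>(2) \<beta>(2)
    by simp_all
  have no_loop: "\<not> \<beta> t \<lless> \<beta> t" if "t \<in> {0<..<b}" for t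
    using no_chron_loop[OF lpls chron_imp_caus[OF p\<beta>[OF that]] fin[OF that]] .
  obtain U where U: "p \<in> interior U" and
    closed: "\<And>x y x' y'. \<lbrakk>\<And>n::nat. x n \<in> U \<and> y n \<in> U \<and> x n \<preceq> y n; x' \<in> closure U;
       y' \<in> closure U; x \<longlonglongrightarrow> x'; y \<longlonglongrightarrow> y'\<rbrakk> \<Longrightarrow> x' \<preceq> y'"
    using lcc unfolding locally_causally_closed_def by (metis (no_types, lifting))
  obtain r1 where r1: "0 < r1" "r1 < b" "\<And>t. 0 \<le> t \<Longrightarrow> t \<le> r1 \<Longrightarrow> \<alpha> t \<in> U"
    by (rule curve_near_start[OF \<alpha>c \<open>0 < b\<close> U[folded \<alpha>(2)]]) blast
  obtain r2 where r2: "0 < r2" "r2 < b" "\<And>t. 0 \<le> t \<Longrightarrow> t \<le> r2 \<Longrightarrow> \<beta> t \<in> U"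
    by (rule curve_near_start[OF \<beta>c \<open>0 < b\<close> U[folded \<beta>(2)]]) blast
  have UcU: "U \<subseteq> closure U" by (rule closure_subset)
  define t0 where "t0 = min r2 (\<delta> / 2)"
  define s1 where "s1 = min r1 (\<delta> / 2)"
  have t0: "0 < t0" "t0 < b" "t0 < \<delta>" "t0 \<le> r2" and s1: "0 < s1" "s1 < b" "s1 < \<delta>" "s1 \<le> r1"
    using r1 r2 \<open>0 < \<delta>\<close> by (auto simp: t0_def s1_def)
  \<comment> \<open>If \<open>\<beta> t0\<close> were below \<open>\<alpha> s\<close> for all small \<open>s\<close>, letting \<open>s\<close> tend to \<open>0\<close> would give \<open>\<beta> t0 \<preceq> p \<lless> \<beta> t0\<close>.\<close>
  have "\<exists>s. 0 < s \<and> s \<le> s1 \<and> \<not> \<beta> t0 \<preceq> \<alpha> s"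
  proof (rule ccontr)
    assume "\<not> ?thesis"
    then have all: "\<beta> t0 \<preceq> \<alpha> s" if "0 < s" "s \<le> s1" for s
      using that by blast
    define \<sigma> where "\<sigma> n = s1 / real (Suc n)" for n
    have \<sigma>: "0 < \<sigma> n" "\<sigma> n \<le> s1" for n
      using s1 by (auto simp: \<sigma>_def field_simps)
    have "\<sigma> \<longlonglongrightarrow> 0"
      unfolding \<sigma>_def by (intro LIMSEQ_Suc lim_const_over_n)
    then have "(\<lambda>n. \<alpha> (\<sigma> n)) \<longlonglongrightarrow> \<alpha> 0"
      using \<sigma> s1 \<open>0 < b\<close>
      by (intro continuous_on_tendsto_compose[OF \<alpha>c])
        (auto intro!: always_eventually intro: less_imp_le le_less_trans)
    moreover have "\<alpha> (\<sigma> n) \<in> U" "\<beta> t0 \<preceq> \<alpha> (\<sigma> n)" for n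
      using all[OF \<sigma>] r1(3)[of "\<sigma> n"] \<sigma>[of n] s1 by auto
    moreover have "\<beta> t0 \<in> U" using r2(3)[of t0] t0 by auto
    moreover have "p \<in> U" using U interior_subset by blast
    ultimately have "\<beta> t0 \<preceq> p"
      using UcU \<alpha>(2)
      by (intro closed[of "\<lambda>_. \<beta> t0" "\<lambda>n. \<alpha> (\<sigma> n)"]) auto
    then have "\<beta> t0 \<lless> \<beta> t0"
      using p\<beta>[of t0] t0 by (auto intro: caus_chron_trans[OF lpls])
    then show False using no_loop[of t0] t0 by auto
  qed
  then obtain s where s: "0 < s" "s \<le> s1" "\<not> \<beta> t0 \<preceq> \<alpha> s" by blast
  define S where "S = {t \<in> {0..t0}. \<beta> t \<preceq> \<alpha> s}"
  define T where "T = Sup S"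
  have s_in: "s \<in> {0<..<b}" using s s1 by auto
  have "0 \<in> S" using p\<alpha>[OF s_in] \<beta>(2) t0 by (auto simp: S_def chron_imp_caus)
  have "bdd_above S" by (auto simp: S_def)
  have "closed S"
    unfolding closed_sequential_limits
  proof (intro allI impI)
    fix x l assume x: "(\<forall>n. x n \<in> S) \<and> x \<longlonglongrightarrow> l"
    have "closed {0..t0}" by simp
    then have l: "l \<in> {0..t0}"
      using x unfolding closed_sequential_limits S_def by blast
    have x0: "x n \<in> {0..t0}" "\<beta> (x n) \<preceq> \<alpha> s" for n using x by (auto simp: S_def)
    have "(\<lambda>n. \<beta> (x n)) \<longlonglongrightarrow> \<beta> l"
      using x x0 l t0
      by (intro continuous_on_tendsto_compose[OF \<beta>c])
        (auto intro!: always_eventually intro: le_less_trans)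
    moreover have "\<beta> (x n) \<in> U" for n using r2(3)[of "x n"] x0[of n] t0 by auto
    moreover have "\<beta> l \<in> U" "\<alpha> s \<in> U" using r2(3)[of l] l t0 r1(3)[of s] s s1 by auto
    ultimately have "\<beta> l \<preceq> \<alpha> s"
      using x0 UcU by (intro closed[of "\<lambda>n. \<beta> (x n)" "\<lambda>_. \<alpha> s"]) auto
    with l show "l \<in> S" by (simp add: S_def)
  qed
  then have "T \<in> S"
    unfolding T_def using \<open>0 \<in> S\<close> \<open>bdd_above S\<close> by (intro closed_contains_Sup) auto
  then have T: "0 \<le> T" "T \<le> t0" "\<beta> T \<preceq> \<alpha> s" by (auto simp: S_def)
  have "T \<noteq> t0" using T s by auto
  \<comment> \<open>Otherwise \<open>\<beta>\<close> would remain below \<open>\<alpha> s\<close> slightly beyond \<open>T\<close>, which is possible since \<open>T < t0\<close>.\<close>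
  have null: "\<not> \<beta> T \<lless> \<alpha> s"
  proof
    assume "\<beta> T \<lless> \<alpha> s"
    moreover have "open ((\<lambda>x. (x, \<alpha> s)) -` {(x, y). x \<lless> y})"
      by (intro open_vimage open_chron[OF lpls] continuous_intros)
    ultimately obtain e where e: "0 < e" "\<And>x. dist x (\<beta> T) < e \<Longrightarrow> x \<lless> \<alpha> s"
      unfolding open_dist by auto
    have "T \<in> {0..<b}" using T t0 by simp
    then obtain d where d: "0 < d" "\<And>t. t \<in> {0..<b} \<Longrightarrow> dist t T < d \<Longrightarrow> dist (\<beta> t) (\<beta> T) < e"
      using \<beta>c[unfolded continuous_on_iff, rule_format, OF _ e(1)] by blast
    define t where "t = min t0 (T + d / 2)"
    have "T < t" "t \<le> t0" "dist t T < d"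
      using T d \<open>T \<noteq> t0\<close> by (auto simp: t_def dist_real_def)
    then have "t \<in> S"
      using d(2)[of t] e(2) T t0 by (auto simp: S_def chron_imp_caus)
    then have "t \<le> T" unfolding T_def using \<open>bdd_above S\<close> by (intro cSup_upper)
    then show False using \<open>T < t\<close> by simp
  qed
  have "T \<noteq> 0" using null p\<alpha>[OF s_in] \<beta>(2) by auto
  then have T_in: "T \<in> {0<..<b}" using T t0 by auto
  have "\<not> \<alpha> s \<lless> \<beta> T"
    using caus_chron_trans[OF lpls T(3)] no_loop[OF T_in] by blast
  then show thesis
    using that[of s T] T_in s_in T null s s1 t0 by auto
qed

text \<open>
  The past directed case is the future directed one for the reversed relations, which also form a
  Lorentzian pre-length space.
\<close>

lemma null_related_pair:
  fixes chron :: "'a::metric_space \<Rightarrow> 'a \<Rightarrow> bool"  (infix "\<lless>" 50)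
    and caus :: "'a \<Rightarrow> 'a \<Rightarrow> bool"  (infix "\<preceq>" 50)
  assumes lpls: "lorentzian_pre_length_space chron caus \<tau>"
    and lcc: "locally_causally_closed caus"
    and "0 < b" "0 < \<delta>"
    and curves: "(future_timelike_curve chron {0..<b} \<alpha> \<and> future_timelike_curve chron {0..<b} \<beta>) \<or>
         (past_timelike_curve chron {0..<b} \<alpha> \<and> past_timelike_curve chron {0..<b} \<beta>)"
    and "\<alpha> 0 = p" "\<beta> 0 = p"
    and fin: "\<And>t. t \<in> {0<..<b} \<Longrightarrow> max (\<tau> p (\<beta> t)) (\<tau> (\<beta> t) p) < \<infinity>"
  obtains s t where "s < \<delta>" "t < \<delta>" "(s, t) \<in> causally_related_params caus b \<alpha> \<beta>"
    "\<not> \<beta> t \<lless> \<alpha> s" "\<not> \<alpha> s \<lless> \<beta> t"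
  using curves
proof (elim disjE conjE)
  assume "future_timelike_curve chron {0..<b} \<alpha>" "future_timelike_curve chron {0..<b} \<beta>"
  note fut = this
  obtain s t where "0 < s" "s < b" "s < \<delta>" "0 < t" "t < b" "t < \<delta>"
    "\<beta> t \<preceq> \<alpha> s" "\<not> \<beta> t \<lless> \<alpha> s" "\<not> \<alpha> s \<lless> \<beta> t"
    by (rule null_related_pair_future[OF lpls lcc \<open>0 < b\<close> \<open>0 < \<delta>\<close> fut(1) \<open>\<alpha> 0 = p\<close> fut(2) \<open>\<beta> 0 = p\<close>])
      (use fin(1) in \<open>simp_all only: max_less_iff_conj\<close>)
  then show thesis
    by (intro that[of s t]) (simp_all add: causally_related_params_def)
next
  assume "past_timelike_curve chron {0..<b} \<alpha>" "past_timelike_curve chron {0..<b} \<beta>"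
  then have fut: "future_timelike_curve (\<lambda>x y. y \<lless> x) {0..<b} \<alpha>"
    "future_timelike_curve (\<lambda>x y. y \<lless> x) {0..<b} \<beta>"
    unfolding past_timelike_curve_def future_timelike_curve_def by auto
  obtain s t where "0 < s" "s < b" "s < \<delta>" "0 < t" "t < b" "t < \<delta>"
    "\<alpha> s \<preceq> \<beta> t" "\<not> \<alpha> s \<lless> \<beta> t" "\<not> \<beta> t \<lless> \<alpha> s"
    by (rule null_related_pair_future[OF lorentzian_pre_length_space_dual[OF lpls]
          locally_causally_closed_dual[OF lcc] \<open>0 < b\<close> \<open>0 < \<delta>\<close> fut(1) \<open>\<alpha> 0 = p\<close> fut(2) \<open>\<beta> 0 = p\<close>])
      (use fin(1) in \<open>simp_all only: max_less_iff_conj\<close>)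
  then show thesis
    by (intro that[of s t]) (simp_all add: causally_related_params_def)
qed

section \<open>Comparison of the time separations\<close>

lemma weighted_length_le:
  assumes "a < b" "\<And>r. r \<in> {a..b} \<Longrightarrow> \<Omega> (\<gamma> r) \<le> c"
  shows "weighted_length \<tau> \<Omega> a b \<gamma> \<le> ennreal c * \<tau> (\<gamma> a) (\<gamma> b)"
proof -
  \<comment> \<open>the partition without interior points\<close>
  define t where "t i = (if i = 0 then a else b)" for i :: nat
  have "weighted_length \<tau> \<Omega> a b \<gamma> \<le>
      (\<Sum>i<1. (SUP r\<in>{t i..t (Suc i)}. ennreal (\<Omega> (\<gamma> r))) * \<tau> (\<gamma> (t i)) (\<gamma> (t (Suc i))))"
    unfolding weighted_length_def
    by (intro Inf_lower CollectI exI[of _ "1::nat"] exI[of _ t]) (use assms(1) in \<open>auto simp: t_def\<close>)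
  also have "\<dots> = (SUP r\<in>{a..b}. ennreal (\<Omega> (\<gamma> r))) * \<tau> (\<gamma> a) (\<gamma> b)"
    by (simp add: t_def)
  also have "\<dots> \<le> ennreal c * \<tau> (\<gamma> a) (\<gamma> b)"
    using assms(2) by (intro mult_right_mono SUP_least ennreal_leI) auto
  finally show ?thesis .
qed

lemma weighted_length_ge:
  assumes "\<And>r. r \<in> {a..b} \<Longrightarrow> c \<le> \<Omega> (\<gamma> r)"
  shows "ennreal c * weighted_length \<tau> (\<lambda>_. 1) a b \<gamma> \<le> weighted_length \<tau> \<Omega> a b \<gamma>"
  unfolding weighted_length_def[of \<tau> \<Omega>]
proof (rule Inf_greatest, clarify)
  fix m :: nat and t :: "nat \<Rightarrow> real"
  assume t: "a = t 0" "b = t m" and inc: "\<forall>i<m. t i < t (Suc i)"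
  have mono: "t i \<le> t j" if "i \<le> j" "j \<le> m" for i j
    using that
  proof (induction j rule: dec_induct)
    case (step n)
    then have "t n < t (Suc n)" using inc by simp
    with step show ?case by simp
  qed simp
  have "ennreal c * weighted_length \<tau> (\<lambda>_. 1) (t 0) (t m) \<gamma> \<le>
     ennreal c * (\<Sum>i<m. (SUP r\<in>{t i..t (Suc i)}. ennreal 1) * \<tau> (\<gamma> (t i)) (\<gamma> (t (Suc i))))"
    unfolding weighted_length_def
    by (intro mult_left_mono Inf_lower CollectI exI[of _ m] exI[of _ t]) (use inc in auto)
  also have "\<dots> = (\<Sum>i<m. ennreal c * \<tau> (\<gamma> (t i)) (\<gamma> (t (Suc i))))"
    using inc by (simp add: sum_distrib_left less_imp_le)
  also have "\<dots> \<le> (\<Sum>i<m. (SUP r\<in>{t i..t (Suc i)}. ennreal (\<Omega> (\<gamma> r))) * \<tau> (\<gamma> (t i)) (\<gamma> (t (Suc i))))"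
  proof (intro sum_mono mult_right_mono)
    fix i assume "i \<in> {..<m}"
    then have "c \<le> \<Omega> (\<gamma> (t i))"
      using assms[of "t i"] t mono[of 0 i] mono[of i m] by auto
    moreover have "t i \<in> {t i..t (Suc i)}" using inc \<open>i \<in> {..<m}\<close> by (auto intro: less_imp_le)
    ultimately show "ennreal c \<le> (SUP r\<in>{t i..t (Suc i)}. ennreal (\<Omega> (\<gamma> r)))"
      by (intro SUP_upper2[of "t i"]) (auto intro: ennreal_leI)
  qed simp
  finally show "ennreal c * weighted_length \<tau> (\<lambda>_. 1) (t 0) (t m) \<gamma> \<le>
    (\<Sum>i<m. (SUP r\<in>{t i..t (Suc i)}. ennreal (\<Omega> (\<gamma> r))) * \<tau> (\<gamma> (t i)) (\<gamma> (t (Suc i))))" .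
qed

lemma causal_curve_from_to_less:
  assumes "causal_curve_from_to caus x y a b \<gamma>"
  shows "a < b"
proof (rule ccontr)
  assume "\<not> a < b"
  then have "a = b" using assms by (simp add: causal_curve_from_to_def)
  then have "\<gamma> constant_on {a..b}" by (simp add: constant_on_def)
  then show False
    using assms unfolding causal_curve_from_to_def causal_curve_def by blast
qed

text \<open>
  Causal curves between points of \<open>V\<close> stay where \<open>\<Omega>\<close> is close to \<open>\<Omega> p\<close>. The upper bound then
  follows from the trivial partition, the lower bound from comparing the lengths of each curve
  and taking suprema, which gives \<open>\<tau>\<close> because the space is intrinsic.
\<close>

lemma weighted_time_separation_comparable:
  fixes \<Omega> :: "'a::metric_space \<Rightarrow> real"
  assumes intr: "intrinsic caus \<tau>" and qsc: "quasi_strongly_causal caus"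
    and cont: "continuous_on UNIV \<Omega>" and pos: "0 < \<Omega> p" and "0 < \<epsilon>"
  obtains V where "p \<in> interior V"
    "\<And>x y. x \<in> V \<Longrightarrow> y \<in> V \<Longrightarrow>
       weighted_time_separation caus \<tau> \<Omega> x y \<le> ennreal (\<Omega> p * exp \<epsilon>) * \<tau> x y"
    "\<And>x y. x \<in> V \<Longrightarrow> y \<in> V \<Longrightarrow>
       ennreal (\<Omega> p * exp (-\<epsilon>)) * \<tau> x y \<le> weighted_time_separation caus \<tau> \<Omega> x y"
proof -
  define U where "U = \<Omega> -` {\<Omega> p * exp (-\<epsilon>)<..<\<Omega> p * exp \<epsilon>}"
  have "open U" unfolding U_def by (intro open_vimage cont) simp
  moreover have "p \<in> U" using pos \<open>0 < \<epsilon>\<close> by (simp add: U_def)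
  ultimately have "p \<in> interior U" by (simp add: interior_open)
  from qsc[unfolded quasi_strongly_causal_def, THEN spec, THEN spec, THEN mp, OF this]
  obtain V where V: "p \<in> interior V"
    "\<And>y z a b \<gamma>. y \<in> V \<Longrightarrow> z \<in> V \<Longrightarrow> causal_curve_from_to caus y z a b \<gamma> \<Longrightarrow> \<gamma> ` {a..b} \<subseteq> U"
    by (elim exE conjE) blast
  show thesis
  proof (rule that[OF V(1)])
    fix x y assume xy: "x \<in> V" "y \<in> V"
    have \<Omega>: "\<Omega> (\<gamma> r) \<le> \<Omega> p * exp \<epsilon>" "\<Omega> p * exp (-\<epsilon>) \<le> \<Omega> (\<gamma> r)"
      if "causal_curve_from_to caus x y a b \<gamma>" "r \<in> {a..b}" for a b \<gamma> r
      using imageI[OF that(2), THEN subsetD[OF V(2)[OF xy that(1)]]] by (auto simp: U_def)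
    show "weighted_time_separation caus \<tau> \<Omega> x y \<le> ennreal (\<Omega> p * exp \<epsilon>) * \<tau> x y"
      unfolding weighted_time_separation_def
    proof (rule Sup_least, safe)
      fix a b \<gamma> assume \<gamma>: "causal_curve_from_to caus x y a b \<gamma>"
      then show "weighted_length \<tau> \<Omega> a b \<gamma> \<le> ennreal (\<Omega> p * exp \<epsilon>) * \<tau> x y"
        using weighted_length_le[of a b \<Omega> \<gamma> "\<Omega> p * exp \<epsilon>" \<tau>] causal_curve_from_to_less[OF \<gamma>] \<Omega>(1)[OF \<gamma>]
        by (simp add: causal_curve_from_to_def)
    qed simp
    have "ennreal (\<Omega> p * exp (-\<epsilon>)) * \<tau> x y =
      (SUP l\<in>{0} \<union> {weighted_length \<tau> (\<lambda>_. 1) a b \<gamma> |a b \<gamma>. causal_curve_from_to caus x y a b \<gamma>}.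
        ennreal (\<Omega> p * exp (-\<epsilon>)) * l)"
      using SUP_mult_left_ennreal[of _ "\<lambda>l. l", unfolded image_ident]
        intr[unfolded intrinsic_def weighted_time_separation_def]
      by (simp only:)
    also have "\<dots> \<le> weighted_time_separation caus \<tau> \<Omega> x y"
    proof (rule SUP_least, safe)
      fix a b \<gamma> assume \<gamma>: "causal_curve_from_to caus x y a b \<gamma>"
      have "ennreal (\<Omega> p * exp (-\<epsilon>)) * weighted_length \<tau> (\<lambda>_. 1) a b \<gamma> \<le> weighted_length \<tau> \<Omega> a b \<gamma>"
        using \<Omega>(2)[OF \<gamma>] by (rule weighted_length_ge)
      also have "\<dots> \<le> weighted_time_separation caus \<tau> \<Omega> x y"
        unfolding weighted_time_separation_def using \<gamma> by (intro Sup_upper) auto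
      finally show "ennreal (\<Omega> p * exp (-\<epsilon>)) * weighted_length \<tau> (\<lambda>_. 1) a b \<gamma> \<le>
        weighted_time_separation caus \<tau> \<Omega> x y" .
    qed simp
    finally show "ennreal (\<Omega> p * exp (-\<epsilon>)) * \<tau> x y \<le> weighted_time_separation caus \<tau> \<Omega> x y" .
  qed
qed

section \<open>Comparison angles at causally but not chronologically related points\<close>

text \<open>
  For \<open>C = 0\<close> the right hand side of the law of cosines is \<open>(A/B + B/A) / 2\<close>, which is the hyperbolic
  cosine of \<open>ln (A/B)\<close>. So the angle depends on the sides only through a difference of logarithms.
\<close>

lemma comparison_angle_null:
  assumes "sym_separation \<theta> x y = 0"
    and "0 < enn2real (sym_separation \<theta> p x)" "0 < enn2real (sym_separation \<theta> p y)"
  shows "comparison_angle \<theta> p x y =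
    \<bar>ln (enn2real (sym_separation \<theta> p x)) - ln (enn2real (sym_separation \<theta> p y))\<bar>"
proof -
  define A B where "A = enn2real (sym_separation \<theta> p x)" and "B = enn2real (sym_separation \<theta> p y)"
  have "0 < A" "0 < B" using assms by (auto simp: A_def B_def)
  then have "(A\<^sup>2 + B\<^sup>2 - 0\<^sup>2) / (2 * A * B) = (A / B + inverse (A / B)) / 2"
    by (simp add: field_simps power2_eq_square)
  also have "\<dots> = cosh \<bar>ln A - ln B\<bar>"
    using \<open>0 < A\<close> \<open>0 < B\<close> cosh_ln_real[of "A / B"] by (simp add: ln_div)
  finally have "arcosh ((A\<^sup>2 + B\<^sup>2 - 0\<^sup>2) / (2 * A * B)) = \<bar>ln A - ln B\<bar>"
    by (simp only: arcosh_cosh_real[OF abs_ge_zero])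
  then show ?thesis
    using assms(1) by (simp add: comparison_angle_def A_def B_def)
qed

lemma ln_enn2real_comparable:
  assumes "0 < c" "0 < a" "a < \<infinity>"
    and "ennreal (c * exp (-\<epsilon>)) * a \<le> a'" "a' \<le> ennreal (c * exp \<epsilon>) * a"
  shows "0 < enn2real a'" "\<bar>ln (enn2real a') - (ln c + ln (enn2real a))\<bar> \<le> \<epsilon>"
proof -
  obtain r where r: "a = ennreal r" "0 < r"
    using assms(2,3) by (cases a) auto
  then obtain r' where r': "a' = ennreal r'" "0 \<le> r'"
    using assms(1,5) by (cases a') (auto simp: ennreal_mult[symmetric] top_unique)
  have le: "c * exp (-\<epsilon>) * r \<le> r'" "r' \<le> c * exp \<epsilon> * r"
    using assms(1,4,5) r r' by (auto simp: ennreal_mult[symmetric] ennreal_le_iff)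
  have "0 < c * exp (-\<epsilon>) * r" using assms(1) r by simp
  with le have "0 < r'" by linarith
  then show "0 < enn2real a'" using r' by simp
  have "ln (c * exp (-\<epsilon>) * r) \<le> ln r'" "ln r' \<le> ln (c * exp \<epsilon> * r)"
    using le \<open>0 < r'\<close> \<open>0 < c * exp (-\<epsilon>) * r\<close> by (auto simp: ln_le_cancel_iff)
  then show "\<bar>ln (enn2real a') - (ln c + ln (enn2real a))\<bar> \<le> \<epsilon>"
    using r r' assms(1) by (simp add: ln_mult abs_le_iff)
qed

text \<open>
  A common factor \<open>c\<close> shifts the logarithms of both sides adjacent to \<open>p\<close> by the same amount \<open>ln c\<close>, and so
  cancels in their difference; each of the two sides contributes an error of at most \<open>\<epsilon>\<close>. The upper
  bound forces the third side to vanish for \<open>\<theta>'\<close> as well.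
\<close>

lemma comparison_angle_null_close:
  assumes "0 < c"
    and upper: "\<And>u v. u \<in> {p, x, y} \<Longrightarrow> v \<in> {p, x, y} \<Longrightarrow> \<theta>' u v \<le> ennreal (c * exp \<epsilon>) * \<theta> u v"
    and lower: "\<And>u v. u \<in> {p, x, y} \<Longrightarrow> v \<in> {p, x, y} \<Longrightarrow> ennreal (c * exp (-\<epsilon>)) * \<theta> u v \<le> \<theta>' u v"
    and x: "0 < sym_separation \<theta> p x" "sym_separation \<theta> p x < \<infinity>"
    and y: "0 < sym_separation \<theta> p y" "sym_separation \<theta> p y < \<infinity>"
    and null: "sym_separation \<theta> x y = 0"
  shows "\<bar>comparison_angle \<theta>' p x y - comparison_angle \<theta> p x y\<bar> \<le> 2 * \<epsilon>"
proof -
  have up: "sym_separation \<theta>' u v \<le> ennreal (c * exp \<epsilon>) * sym_separation \<theta> u v"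
    and lo: "ennreal (c * exp (-\<epsilon>)) * sym_separation \<theta> u v \<le> sym_separation \<theta>' u v"
    if uv: "u \<in> {p, x, y}" "v \<in> {p, x, y}" for u v
  proof -
    show "sym_separation \<theta>' u v \<le> ennreal (c * exp \<epsilon>) * sym_separation \<theta> u v"
      unfolding sym_separation_def
      by (intro max.boundedI order_trans[OF upper mult_left_mono] uv) auto
    have "ennreal (c * exp (-\<epsilon>)) * \<theta> u v \<le> sym_separation \<theta>' u v"
      "ennreal (c * exp (-\<epsilon>)) * \<theta> v u \<le> sym_separation \<theta>' u v"
      unfolding sym_separation_def
      by (intro order_trans[OF lower max.cobounded1] order_trans[OF lower max.cobounded2] uv)+
    then show "ennreal (c * exp (-\<epsilon>)) * sym_separation \<theta> u v \<le> sym_separation \<theta>' u v"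
      unfolding sym_separation_def[of \<theta>] by (cases "\<theta> u v \<le> \<theta> v u") (simp_all add: max_def)
  qed
  have null': "sym_separation \<theta>' x y = 0"
    using up[of x y] null by simp
  have sides: "0 < enn2real (sym_separation \<theta> p v) \<and> 0 < enn2real (sym_separation \<theta>' p v) \<and>
      \<bar>ln (enn2real (sym_separation \<theta>' p v)) - (ln c + ln (enn2real (sym_separation \<theta> p v)))\<bar> \<le> \<epsilon>"
    if v: "v \<in> {x, y}" for v
  proof -
    have "0 < sym_separation \<theta> p v" "sym_separation \<theta> p v < \<infinity>" "p \<in> {p, x, y}" "v \<in> {p, x, y}"
      using v x y by auto
    with ln_enn2real_comparable[OF \<open>0 < c\<close> _ _ lo up, of p v] show ?thesis
      by (simp add: enn2real_positive_iff)
  qed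
  show ?thesis
    using sides[of x] sides[of y] null null' by (simp add: comparison_angle_null abs_le_iff) linarith
qed

section \<open>Equality of the angles\<close>

text \<open>
  Pairs of parameters at which the two comparison angles are close show that the filter of
  admissible parameters is non-trivial, and that the two limits agree, also if they are infinite.
\<close>

lemma angle_eq_if_close_pairs:
  assumes ex: "angle_exists caus \<theta> b p \<alpha> \<beta>" "angle_exists caus \<theta>' b p \<alpha> \<beta>"
    and close: "\<And>\<epsilon>. 0 < \<epsilon> \<Longrightarrow> \<exists>s t. s < \<epsilon> \<and> t < \<epsilon> \<and> (s, t) \<in> causally_related_params caus b \<alpha> \<beta> \<and>
       \<bar>comparison_angle \<theta>' p (\<alpha> s) (\<beta> t) - comparison_angle \<theta> p (\<alpha> s) (\<beta> t)\<bar> \<le> 2 * \<epsilon>"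
  shows "angle caus \<theta>' b p \<alpha> \<beta> = angle caus \<theta> b p \<alpha> \<beta>"
proof -
  define F where "F = at (0::real, 0::real) within causally_related_params caus b \<alpha> \<beta>"
  define f where "f \<theta> = (\<lambda>(s, t). comparison_angle \<theta> p (\<alpha> s) (\<beta> t))" for \<theta>
  define e where "e n = inverse (real (Suc n))" for n
  have e: "e \<longlonglongrightarrow> 0" unfolding e_def by (rule LIMSEQ_inverse_real_of_nat)
  have "\<exists>z. fst z < e n \<and> snd z < e n \<and> z \<in> causally_related_params caus b \<alpha> \<beta> \<and>
      \<bar>f \<theta>' z - f \<theta> z\<bar> \<le> 2 * e n" for n
    using close[of "e n"] by (auto simp: f_def e_def)
  then obtain z where z: "\<And>n. fst (z n) < e n" "\<And>n. snd (z n) < e n"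
    "\<And>n. z n \<in> causally_related_params caus b \<alpha> \<beta>" "\<And>n. \<bar>f \<theta>' (z n) - f \<theta> (z n)\<bar> \<le> 2 * e n"
    by metis
  have pos: "0 < fst (z n)" "0 < snd (z n)" for n
    using z(3)[of n] by (auto simp: causally_related_params_def)
  have "(\<lambda>n. fst (z n)) \<longlonglongrightarrow> 0" "(\<lambda>n. snd (z n)) \<longlonglongrightarrow> 0"
    using pos z(1,2) by (auto intro!: tendsto_sandwich[OF _ _ tendsto_const e] always_eventually less_imp_le)
  then have "(\<lambda>n. (fst (z n), snd (z n))) \<longlonglongrightarrow> (0, 0)"
    by (rule tendsto_Pair)
  moreover have "z n \<noteq> (0, 0)" for n using pos[of n] by auto
  ultimately have zF: "filterlim z F sequentially"
    unfolding F_def using z(3) by (auto simp: filterlim_at intro!: always_eventually)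
  then have F: "F \<noteq> bot"
    by (metis filterlim_at_top_imp_at_infinity filtermap_bot_iff filterlim_def le_bot
        trivial_limit_sequentially)
  obtain L L' where L: "((\<lambda>z. ereal (f \<theta> z)) \<longlongrightarrow> L) F" and L': "((\<lambda>z. ereal (f \<theta>' z)) \<longlongrightarrow> L') F"
    using ex unfolding angle_exists_def f_def F_def by (auto simp: case_prod_unfold)
  have "(\<lambda>n. f \<theta>' (z n) - f \<theta> (z n)) \<longlonglongrightarrow> 0"
  proof (rule Lim_null_comparison)
    show "\<forall>\<^sub>F n in sequentially. norm (f \<theta>' (z n) - f \<theta> (z n)) \<le> 2 * e n"
      unfolding real_norm_def by (intro always_eventually allI z(4))
    show "(\<lambda>n. 2 * e n) \<longlonglongrightarrow> 0" by (rule tendsto_mult_right_zero[OF e])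
  qed
  then have "(\<lambda>n. ereal (f \<theta>' (z n) - f \<theta> (z n))) \<longlonglongrightarrow> ereal 0" by simp
  then have "(\<lambda>n. ereal (f \<theta> (z n)) + ereal (f \<theta>' (z n) - f \<theta> (z n))) \<longlonglongrightarrow> L + ereal 0"
    by (intro tendsto_add_ereal_general filterlim_compose[OF L zF]) auto
  then have "(\<lambda>n. ereal (f \<theta>' (z n))) \<longlonglongrightarrow> L" by simp
  with filterlim_compose[OF L' zF] have "L' = L"
    by (rule LIMSEQ_unique)
  moreover have "angle caus \<theta> b p \<alpha> \<beta> = L" "angle caus \<theta>' b p \<alpha> \<beta> = L'"
    using tendsto_Lim[OF F L] tendsto_Lim[OF F L']
    by (auto simp: angle_def F_def f_def case_prod_unfold)
  ultimately show ?thesis by simp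
qed

theorem theorem3p22:
  fixes chron caus :: "'a::metric_space \<Rightarrow> 'a \<Rightarrow> bool"
    and \<tau> :: "'a \<Rightarrow> 'a \<Rightarrow> ennreal"
    and \<Omega> :: "'a \<Rightarrow> real"
    and \<alpha> \<beta> :: "real \<Rightarrow> 'a"
    and b :: real
    and p :: 'a
  assumes "lorentzian_pre_length_space chron caus \<tau>"
    and "intrinsic caus \<tau>"
    and "quasi_strongly_causal caus"
    and "locally_causally_closed caus"
    and "continuous_on UNIV \<Omega>"
    and "\<And>x. 0 < \<Omega> x"
    and "0 < b"
    and "(future_timelike_curve chron {0..<b} \<alpha> \<and> future_timelike_curve chron {0..<b} \<beta>) \<or>
         (past_timelike_curve chron {0..<b} \<alpha> \<and> past_timelike_curve chron {0..<b} \<beta>)"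
    and "\<alpha> 0 = p"
    and "\<beta> 0 = p"
    and "\<And>s. s \<in> {0<..<b} \<Longrightarrow> max (\<tau> p (\<alpha> s)) (\<tau> (\<alpha> s) p) < \<infinity>"
    and "\<And>s. s \<in> {0<..<b} \<Longrightarrow> max (\<tau> p (\<beta> s)) (\<tau> (\<beta> s) p) < \<infinity>"
    and "angle_exists caus \<tau> b p \<alpha> \<beta>"
    and "angle_exists caus (weighted_time_separation caus \<tau> \<Omega>) b p \<alpha> \<beta>"
  shows "angle caus (weighted_time_separation caus \<tau> \<Omega>) b p \<alpha> \<beta> = angle caus \<tau> b p \<alpha> \<beta>"
proof (rule angle_eq_if_close_pairs[OF assms(13,14)])
  fix \<epsilon> :: real assume "0 < \<epsilon>"
  obtain V where V: "p \<in> interior V"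
    "\<And>x y. x \<in> V \<Longrightarrow> y \<in> V \<Longrightarrow>
       weighted_time_separation caus \<tau> \<Omega> x y \<le> ennreal (\<Omega> p * exp \<epsilon>) * \<tau> x y"
    "\<And>x y. x \<in> V \<Longrightarrow> y \<in> V \<Longrightarrow>
       ennreal (\<Omega> p * exp (-\<epsilon>)) * \<tau> x y \<le> weighted_time_separation caus \<tau> \<Omega> x y"
    by (rule weighted_time_separation_comparable[OF assms(2,3,5,6) \<open>0 < \<epsilon>\<close>, of p]) blast
  have cont: "continuous_on {0..<b} \<alpha>" "continuous_on {0..<b} \<beta>"
    using assms(8) unfolding future_timelike_curve_def past_timelike_curve_def by auto
  obtain r1 where r1: "0 < r1" "r1 < b" "\<And>t. 0 \<le> t \<Longrightarrow> t \<le> r1 \<Longrightarrow> \<alpha> t \<in> V"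
    by (rule curve_near_start[OF cont(1) \<open>0 < b\<close> V(1)[folded \<open>\<alpha> 0 = p\<close>]]) blast
  obtain r2 where r2: "0 < r2" "r2 < b" "\<And>t. 0 \<le> t \<Longrightarrow> t \<le> r2 \<Longrightarrow> \<beta> t \<in> V"
    by (rule curve_near_start[OF cont(2) \<open>0 < b\<close> V(1)[folded \<open>\<beta> 0 = p\<close>]]) blast
  obtain s t where st: "s < min \<epsilon> (min r1 r2)" "t < min \<epsilon> (min r1 r2)"
    "(s, t) \<in> causally_related_params caus b \<alpha> \<beta>" and
    null: "\<not> chron (\<beta> t) (\<alpha> s)" "\<not> chron (\<alpha> s) (\<beta> t)"
    using null_related_pair[OF assms(1,4,7) _ assms(8,9,10,12), of "min \<epsilon> (min r1 r2)"]
      \<open>0 < \<epsilon>\<close> r1(1) r2(1) by auto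
  have s: "s \<in> {0<..<b}" and t: "t \<in> {0<..<b}"
    using st(3) by (auto simp: causally_related_params_def)
  have "chron p (\<alpha> s) \<or> chron (\<alpha> s) p" "chron p (\<beta> t) \<or> chron (\<beta> t) p"
    using assms(8,9,10) future_timelike_curve_start[OF _ s, of chron \<alpha>]
      past_timelike_curve_start[OF _ s, of chron \<alpha>] future_timelike_curve_start[OF _ t, of chron \<beta>]
      past_timelike_curve_start[OF _ t, of chron \<beta>] by metis+
  then have pos: "0 < sym_separation \<tau> p (\<alpha> s)" "0 < sym_separation \<tau> p (\<beta> t)"
    unfolding sym_separation_def by (simp_all add: less_max_iff_disj lorentzian_pre_length_space.tau_pos_iff[OF assms(1)])
  have fin: "sym_separation \<tau> p (\<alpha> s) < \<infinity>" "sym_separation \<tau> p (\<beta> t) < \<infinity>"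
    using assms(11)[OF s] assms(12)[OF t] unfolding sym_separation_def .
  have "\<tau> (\<alpha> s) (\<beta> t) = 0" "\<tau> (\<beta> t) (\<alpha> s) = 0"
    using null by (metis not_gr_zero lorentzian_pre_length_space.tau_pos_iff[OF assms(1)])+
  then have zero: "sym_separation \<tau> (\<alpha> s) (\<beta> t) = 0" by (simp add: sym_separation_def)
  have "\<alpha> s \<in> V" "\<beta> t \<in> V" "p \<in> V"
    using r1(3)[of s] r2(3)[of t] st(1,2) s t subsetD[OF interior_subset V(1)] by simp_all
  then have in_V: "u \<in> V" if "u \<in> {p, \<alpha> s, \<beta> t}" for u using that by blast
  note bounds = V(2)[OF in_V in_V] V(3)[OF in_V in_V]
  have "\<bar>comparison_angle (weighted_time_separation caus \<tau> \<Omega>) p (\<alpha> s) (\<beta> t)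
      - comparison_angle \<tau> p (\<alpha> s) (\<beta> t)\<bar> \<le> 2 * \<epsilon>"
    using assms(6)[of p] bounds pos(1) fin(1) pos(2) fin(2) zero by (rule comparison_angle_null_close)
  then show "\<exists>s t. s < \<epsilon> \<and> t < \<epsilon> \<and> (s, t) \<in> causally_related_params caus b \<alpha> \<beta> \<and>
      \<bar>comparison_angle (weighted_time_separation caus \<tau> \<Omega>) p (\<alpha> s) (\<beta> t)
        - comparison_angle \<tau> p (\<alpha> s) (\<beta> t)\<bar> \<le> 2 * \<epsilon>"
    using st by (intro exI[of _ s] exI[of _ t]) simp
qed

end
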